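(* Let $k\ge 3$ and let $\mathscr{T}\in\mathbb{R}^{n_1\times n_2\times n_3\times\cdots\times n_k}$ be a tensor in the TTD format with core tensors $\mathscr{G}_t\in\mathbb{R}^{r_{t-1}\times n_t\times r_t}$, $t=1,2,\dots,k$ ($r_0=r_k=1$). Define $\widetilde{\mathscr{G}}_t=\mathscr{G}_t\times_2\mathbf{F}_{n_t}\in\mathbb{C}^{r_{t-1}\times n_t\times r_t}$ for $t=3,4,\dots,k$. Then for each frequency tuple $\boldsymbol{j}=(j_3,j_4,\dots,j_k)$, $1\le j_t\le n_t$, the Fourier-domain diagonal block $\mathbf{T}_{\boldsymbol{j}}\in\mathbb{C}^{n_1\times n_2}$ of $\mathscr{T}$ satisfies, for all $j_1=1,\dots,n_1$ and $j_2=1,\dots,n_2$, $$\mathbf{T}_{\boldsymbol{j}}(j_1,j_2)=\sum_{\alpha_1=1}^{r_1}\sum_{\alpha_2=1}^{r_2}\cdots\sum_{\alpha_k=1}^{r_k}\mathscr{G}_1(1,j_1,\alpha_1)\,\mathscr{G}_2(\alpha_1,j_2,\alpha_2)\prod_{t=3}^{k}\widetilde{\mathscr{G}}_t(\alpha_{t-1},j_t,\alpha_t).$$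
   Context: $\mathscr{T}$ is in tensor train (TTD) format with cores $\mathscr{G}_t\in\mathbb{R}^{r_{t-1}\times n_t\times r_t}$, $r_0=r_k=1$, if $\mathscr{T}(j_1,\dots,j_k)=\sum_{\alpha_0,\dots,\alpha_k}\mathscr{G}_1(\alpha_0,j_1,\alpha_1)\mathscr{G}_2(\alpha_1,j_2,\alpha_2)\cdots\mathscr{G}_k(\alpha_{k-1},j_k,\alpha_k)$, where $\alpha_t$ runs over $1,\dots,r_t$. Mode-$p$ multiplication: $(\mathscr{X}\times_p\mathbf{A})(j_1,\dots,j_{p-1},i,j_{p+1},\dots,j_k)=\sum_{j_p}\mathbf{A}(i,j_p)\mathscr{X}(j_1,\dots,j_k)$. $\mathbf{F}_n\in\mathbb{C}^{n\times n}$ is the discrete Fourier transform matrix $\mathbf{F}_n(p,q)=\frac{1}{\sqrt n}\omega^{(p-1)(q-1)}$, $\omega=\exp(-2\pi i/n)$. Let $\widetilde{\mathscr{T}}=\mathscr{T}\times_3\mathbf{F}_{n_3}\times_4\mathbf{F}_{n_4}\times_5\cdots\times_k\mathbf{F}_{n_k}$. The Fourier-domain diagonal block at $\boldsymbol{j}=(j_3,\dots,j_k)$ is $\mathbf{T}_{\boldsymbol{j}}=\widetilde{\mathscr{T}}(:,:,j_3,\dots,j_k)$. *)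

theory Defs
  imports Complex_Main "HOL-Library.FuncSet" "Jordan_Normal_Form.Matrix"
begin

text \<open>Modes are numbered from 1, as usual, but an index into a mode of size \<open>n\<close> ranges over
  \<open>0, ..., n - 1\<close> instead of \<open>1, ..., n\<close>, in agreement with the matrices of
  \<open>Jordan_Normal_Form\<close>. A tensor of order \<open>k\<close> maps index lists of length \<open>k\<close> to its entries;
  its shape is given separately, and the values outside the shape are never used.\<close>

type_synonym 'a tensor = "nat list \<Rightarrow> 'a"

definition tuples :: "nat list \<Rightarrow> nat list set" where
  "tuples ns = {js. list_all2 (<) js ns}"

text \<open>\<open>mode_mult p A X\<close> is \<open>X \<times>\<^sub>p A\<close>, for \<open>X\<close> whose mode \<open>p\<close> has size \<open>dim_col A\<close>; the index of mode
  \<open>p\<close> is found at list position \<open>p - 1\<close>.\<close>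

definition mode_mult :: "nat \<Rightarrow> 'a::comm_semiring_0 mat \<Rightarrow> 'a tensor \<Rightarrow> 'a tensor" where
  "mode_mult p A X = (\<lambda>js. \<Sum>i<dim_col A. A $$ (js ! (p - 1), i) * X (js[p - 1 := i]))"

definition complex_tensor :: "real tensor \<Rightarrow> complex tensor" where
  "complex_tensor X = (\<lambda>js. complex_of_real (X js))"

text \<open>The exponent is \<open>(p - 1) (q - 1)\<close> in the numbering from 1.\<close>

definition dft_mat :: "nat \<Rightarrow> complex mat" where
  "dft_mat n = mat n n (\<lambda>(p, q).
     1 / complex_of_real (sqrt (real n)) * exp (- 2 * complex_of_real pi * \<i> / of_nat n) ^ (p * q))"

definition is_TTD ::
  "nat \<Rightarrow> (nat \<Rightarrow> nat) \<Rightarrow> (nat \<Rightarrow> nat) \<Rightarrow> (nat \<Rightarrow> real tensor) \<Rightarrow> real tensor \<Rightarrow> bool" where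
  "is_TTD k n r G T \<longleftrightarrow> r 0 = 1 \<and> r k = 1 \<and>
     (\<forall>js \<in> tuples (map n [1..<Suc k]).
        T js = (\<Sum>\<alpha> \<in> (\<Pi>\<^sub>E t\<in>{0..k}. {..<r t}). \<Prod>t=1..k. G t [\<alpha> (t - 1), js ! (t - 1), \<alpha> t]))"

text \<open>\<open>T \<times>\<^sub>3 F \<times>\<^sub>4 F \<dots> \<times>\<^sub>k F\<close>, applied in this order.\<close>

definition fourier_tensor :: "nat \<Rightarrow> (nat \<Rightarrow> nat) \<Rightarrow> real tensor \<Rightarrow> complex tensor" where
  "fourier_tensor k n T =
     fold (\<lambda>p. mode_mult p (dft_mat (n p))) [3..<Suc k] (complex_tensor T)"

text \<open>The list \<open>js\<close> is the frequency tuple \<open>(j\<^sub>3, ..., j\<^sub>k)\<close>, so \<open>j\<^sub>t\<close> is \<open>js ! (t - 3)\<close>.\<close>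

definition fourier_block ::
  "nat \<Rightarrow> (nat \<Rightarrow> nat) \<Rightarrow> real tensor \<Rightarrow> nat list \<Rightarrow> complex mat" where
  "fourier_block k n T js =
     mat (n 1) (n 2) (\<lambda>(j1, j2). fourier_tensor k n T (j1 # j2 # js))"

text \<open>The core \<open>G t\<close> multiplied in its middle mode (of size \<open>n t\<close>) by the Fourier matrix.\<close>

definition fourier_core ::
  "(nat \<Rightarrow> nat) \<Rightarrow> (nat \<Rightarrow> real tensor) \<Rightarrow> nat \<Rightarrow> complex tensor" where
  "fourier_core n G t = mode_mult 2 (dft_mat (n t)) (complex_tensor (G t))"

end

theory Submission
  imports Defs
begin

text \<open>Each entry of a tensor in the format is a sum over rank indices of a product of core entries,
  and the index \<open>j\<^sub>p\<close> of mode \<open>p\<close> enters only the factor of the \<open>p\<close>-th core. A mode-\<open>p\<close>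
  multiplication sums over \<open>j\<^sub>p\<close>, so by distributivity this sum can be carried into that one factor,
  where it becomes the multiplication of the middle mode of the core
  (lemma \<open>tensor_train_mode_mult\<close>). A square matrix leaves the shape unchanged, so the step can be
  repeated for \<open>p = 3, \<dots>, k\<close> (lemma \<open>tensor_train_fourier\<close>) and shows that the transformed tensor has
  the cores \<open>G\<^sub>1\<close>, \<open>G\<^sub>2\<close> and the transformed cores for the modes \<open>3, \<dots>, k\<close>. Since \<open>r\<^sub>0 = 1\<close>, the
  index \<open>\<alpha>\<^sub>0\<close> has the value 0 throughout and can be dropped from the sum.\<close>

text \<open>Stated over any commutative semiring because the identity starts as one between real tensors but has to be
  carried through transformations that make the entries complex.\<close>

definition tensor_train ::
  "nat \<Rightarrow> (nat \<Rightarrow> nat) \<Rightarrow> (nat \<Rightarrow> nat) \<Rightarrow> (nat \<Rightarrow> 'a::comm_semiring_1 tensor) \<Rightarrow> 'a tensor \<Rightarrow> bool"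
  where
  "tensor_train k n r H X \<longleftrightarrow>
     (\<forall>js \<in> tuples (map n [1..<Suc k]).
        X js = (\<Sum>\<alpha> \<in> (\<Pi>\<^sub>E t\<in>{0..k}. {..<r t}). \<Prod>t=1..k. H t [\<alpha> (t - 1), js ! (t - 1), \<alpha> t]))"

lemma tuples_length: "js \<in> tuples ns \<Longrightarrow> length js = length ns"
  by (auto simp: tuples_def list_all2_lengthD)

lemma tuples_update:
  assumes "js \<in> tuples ns" "i < ns ! p"
  shows "js[p := i] \<in> tuples ns"
  using assms
  by (cases "p < length js") (simp_all add: tuples_def list_all2_conv_all_nth nth_list_update)

text \<open>For each tuple of rank indices, the factors \<open>t \<noteq> p\<close> do not depend on \<open>j\<^sub>p\<close>. Once the two sums are
  exchanged, they come out of the sum over \<open>j\<^sub>p\<close>, and what stays inside is an entry of the transformed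
  core, in which \<open>j\<^sub>p\<close> sits in mode 2. The matrix needs \<open>n p\<close> columns so that \<open>j\<^sub>p\<close> runs exactly over the
  index range on which the identity for \<open>X\<close> is known.\<close>

lemma tensor_train_mode_mult:
  fixes X :: "'a::comm_semiring_1 tensor"
  assumes X: "tensor_train k n r H X"
    and p: "p \<in> {1..k}" and A: "dim_col A = n p"
  shows "tensor_train k n r (H(p := mode_mult 2 A (H p))) (mode_mult p A X)"
  unfolding tensor_train_def
proof
  fix js assume js: "js \<in> tuples (map n [1..<Suc k])"
  let ?R = "\<Pi>\<^sub>E t\<in>{0..k}. {..<r t}"
  let ?H' = "H(p := mode_mult 2 A (H p))"
  let ?rest = "\<lambda>\<alpha>. \<Prod>t\<in>{1..k} - {p}. H t [\<alpha> (t - 1), js ! (t - 1), \<alpha> t]"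
  have len: "length js = k"
    using tuples_length[OF js] by simp
  have entry: "X (js[p - 1 := i]) = (\<Sum>\<alpha>\<in>?R. H p [\<alpha> (p - 1), i, \<alpha> p] * ?rest \<alpha>)"
    if "i < n p" for i
  proof -
    have "js[p - 1 := i] \<in> tuples (map n [1..<Suc k])"
      using that p by (intro tuples_update[OF js]) (auto simp del: upt_Suc)
    then have "X (js[p - 1 := i]) =
        (\<Sum>\<alpha>\<in>?R. \<Prod>t=1..k. H t [\<alpha> (t - 1), js[p - 1 := i] ! (t - 1), \<alpha> t])"
      using X unfolding tensor_train_def by blast
    also have "\<dots> = (\<Sum>\<alpha>\<in>?R. H p [\<alpha> (p - 1), i, \<alpha> p] * ?rest \<alpha>)"
    proof (rule sum.cong[OF refl])
      fix \<alpha>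
      have "(\<Prod>t\<in>{1..k} - {p}. H t [\<alpha> (t - 1), js[p - 1 := i] ! (t - 1), \<alpha> t]) = ?rest \<alpha>"
        using p by (intro prod.cong) auto
      moreover have "js[p - 1 := i] ! (p - 1) = i"
        using p len by (intro nth_list_update_eq) auto
      ultimately show "(\<Prod>t=1..k. H t [\<alpha> (t - 1), js[p - 1 := i] ! (t - 1), \<alpha> t])
          = H p [\<alpha> (p - 1), i, \<alpha> p] * ?rest \<alpha>"
        using prod.remove[OF _ p, of "\<lambda>t. H t [\<alpha> (t - 1), js[p - 1 := i] ! (t - 1), \<alpha> t]"]
        by simp
    qed
    finally show ?thesis .
  qed
  have "mode_mult p A X js =
      (\<Sum>i<n p. \<Sum>\<alpha>\<in>?R. A $$ (js ! (p - 1), i) * (H p [\<alpha> (p - 1), i, \<alpha> p] * ?rest \<alpha>))"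
    unfolding mode_mult_def A
    by (intro sum.cong refl) (simp only: entry lessThan_iff sum_distrib_left)
  also have "\<dots> = (\<Sum>\<alpha>\<in>?R. \<Sum>i<n p. A $$ (js ! (p - 1), i) * (H p [\<alpha> (p - 1), i, \<alpha> p] * ?rest \<alpha>))"
    by (rule sum.swap)
  also have "\<dots> = (\<Sum>\<alpha>\<in>?R. \<Prod>t=1..k. ?H' t [\<alpha> (t - 1), js ! (t - 1), \<alpha> t])"
  proof (rule sum.cong[OF refl])
    fix \<alpha>
    have rest: "(\<Prod>t\<in>{1..k} - {p}. ?H' t [\<alpha> (t - 1), js ! (t - 1), \<alpha> t]) = ?rest \<alpha>"
      by (intro prod.cong) auto
    have "(\<Sum>i<n p. A $$ (js ! (p - 1), i) * (H p [\<alpha> (p - 1), i, \<alpha> p] * ?rest \<alpha>))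
        = mode_mult 2 A (H p) [\<alpha> (p - 1), js ! (p - 1), \<alpha> p] * ?rest \<alpha>"
      by (simp add: mode_mult_def A sum_distrib_right mult.assoc)
    also have "\<dots> = (\<Prod>t=1..k. ?H' t [\<alpha> (t - 1), js ! (t - 1), \<alpha> t])"
      using prod.remove[OF _ p, of "\<lambda>t. ?H' t [\<alpha> (t - 1), js ! (t - 1), \<alpha> t]"]
      by (simp only: rest finite_atLeastAtMost fun_upd_same simp_thms)
    finally show "(\<Sum>i<n p. A $$ (js ! (p - 1), i) * (H p [\<alpha> (p - 1), i, \<alpha> p] * ?rest \<alpha>))
        = (\<Prod>t=1..k. ?H' t [\<alpha> (t - 1), js ! (t - 1), \<alpha> t])" .
  qed
  finally show "mode_mult p A X js =
      (\<Sum>\<alpha>\<in>?R. \<Prod>t=1..k. ?H' t [\<alpha> (t - 1), js ! (t - 1), \<alpha> t])" .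
qed

lemma tensor_train_complex:
  assumes "is_TTD k n r G T"
  shows "tensor_train k n r (\<lambda>t. complex_tensor (G t)) (complex_tensor T)"
  using assms by (simp add: is_TTD_def tensor_train_def complex_tensor_def del: upt_Suc)

text \<open>The tensor has order \<open>k\<close> throughout; \<open>fourier_tensor m\<close> is the stage at which only the modes
  \<open>3, \<dots>, m\<close> have been transformed. Distinct modes change distinct cores, so the core that mode \<open>m\<close>
  changes is still the original one after the modes \<open>3, \<dots>, m - 1\<close>.\<close>

lemma tensor_train_fourier:
  assumes T: "is_TTD k n r G T" and "m \<le> k"
  shows "tensor_train k n r
           (\<lambda>t. if t \<in> {3..m} then fourier_core n G t else complex_tensor (G t))
           (fourier_tensor m n T)"
  using \<open>m \<le> k\<close>
proof (induction m)
  case 0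
  then show ?case
    using tensor_train_complex[OF T] by (simp add: fourier_tensor_def)
next
  case (Suc m)
  let ?H = "\<lambda>m t. if t \<in> {3..m} then fourier_core n G t else complex_tensor (G t)"
  have IH: "tensor_train k n r (?H m) (fourier_tensor m n T)"
    using Suc by simp
  show ?case
  proof (cases "3 \<le> Suc m")
    case True
    have "(?H m)(Suc m := mode_mult 2 (dft_mat (n (Suc m))) (?H m (Suc m))) = ?H (Suc m)"
      using True by (auto simp: fun_eq_iff fourier_core_def)
    moreover have "mode_mult (Suc m) (dft_mat (n (Suc m))) (fourier_tensor m n T)
        = fourier_tensor (Suc m) n T"
      using True by (simp add: fourier_tensor_def)
    ultimately show ?thesis
      using tensor_train_mode_mult[OF IH, of "Suc m" "dft_mat (n (Suc m))"] Suc.prems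
      by (simp add: dft_mat_def)
  next
    case False
    then have "?H (Suc m) = ?H m" "fourier_tensor (Suc m) n T = fourier_tensor m n T"
      by (auto simp: fun_eq_iff fourier_tensor_def)
    then show ?thesis
      using IH by simp
  qed
qed

text \<open>Both sides sum over extensional functions: \<open>\<alpha> 0\<close> is 0 on the left but \<open>undefined\<close> on the right, so
  the two updates at 0 are mutually inverse.\<close>

lemma sum_PiE_trivial_first_index:
  fixes r :: "nat \<Rightarrow> nat"
  assumes "r 0 = 1"
  shows "(\<Sum>\<alpha> \<in> (\<Pi>\<^sub>E t\<in>{0..k}. {..<r t}). f \<alpha>) = (\<Sum>\<alpha> \<in> (\<Pi>\<^sub>E t\<in>{1..k}. {..<r t}). f (\<alpha>(0 := 0)))"
proof (rule sum.reindex_bij_witness[of _ "\<lambda>\<alpha>. \<alpha>(0 := 0)" "\<lambda>\<alpha>. \<alpha>(0 := undefined)"])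
  fix \<alpha> assume \<alpha>: "\<alpha> \<in> (\<Pi>\<^sub>E t\<in>{0..k}. {..<r t})"
  then have "\<alpha> 0 \<in> {..<r 0}"
    by (rule PiE_mem) simp
  then have "\<alpha> 0 = 0"
    using assms by simp
  then show recover: "(\<alpha>(0 := undefined))(0 := 0) = \<alpha>"
    by auto
  show "\<alpha>(0 := undefined) \<in> (\<Pi>\<^sub>E t\<in>{1..k}. {..<r t})"
    using \<alpha> by (auto simp: PiE_iff extensional_def)
  show "f ((\<alpha>(0 := undefined))(0 := 0)) = f \<alpha>"
    by (simp only: recover)
next
  fix \<alpha> assume \<alpha>: "\<alpha> \<in> (\<Pi>\<^sub>E t\<in>{1..k}. {..<r t})"
  then show "(\<alpha>(0 := 0))(0 := undefined) = \<alpha>"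
    by (auto simp: PiE_iff extensional_def fun_eq_iff)
  show "\<alpha>(0 := 0) \<in> (\<Pi>\<^sub>E t\<in>{0..k}. {..<r t})"
    using \<alpha> assms by (auto simp: PiE_iff extensional_def)
qed

theorem proposition4p1:
  fixes k :: nat and n r :: "nat \<Rightarrow> nat"
    and G :: "nat \<Rightarrow> real tensor" and T :: "real tensor"
    and js :: "nat list" and j1 j2 :: nat
  assumes "k \<ge> 3"
    and "is_TTD k n r G T"
    and "js \<in> tuples (map n [3..<Suc k])"
    and "j1 < n 1" and "j2 < n 2"
  shows "fourier_block k n T js $$ (j1, j2) =
    (\<Sum>\<alpha> \<in> (\<Pi>\<^sub>E t\<in>{1..k}. {..<r t}).
       complex_of_real (G 1 [0, j1, \<alpha> 1]) * complex_of_real (G 2 [\<alpha> 1, j2, \<alpha> 2]) *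
       (\<Prod>t=3..k. fourier_core n G t [\<alpha> (t - 1), js ! (t - 3), \<alpha> t]))"
proof -
  let ?H = "\<lambda>t. if t \<in> {3..k} then fourier_core n G t else complex_tensor (G t)"
  let ?js = "j1 # j2 # js"
  have "[1..<Suc k] = 1 # 2 # [3..<Suc k]"
    using assms(1) by (simp add: upt_conv_Cons numeral_eq_Suc del: upt_Suc)
  then have js: "?js \<in> tuples (map n [1..<Suc k])"
    using assms(3-5) by (simp add: tuples_def del: upt_Suc)
  have "fourier_block k n T js $$ (j1, j2) = fourier_tensor k n T ?js"
    using assms(4,5) by (simp add: fourier_block_def)
  also have "\<dots> = (\<Sum>\<alpha> \<in> (\<Pi>\<^sub>E t\<in>{0..k}. {..<r t}). \<Prod>t=1..k. ?H t [\<alpha> (t - 1), ?js ! (t - 1), \<alpha> t])"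
    using tensor_train_fourier[OF assms(2) order_refl] js unfolding tensor_train_def by blast
  also have "\<dots> = (\<Sum>\<alpha> \<in> (\<Pi>\<^sub>E t\<in>{1..k}. {..<r t}).
      \<Prod>t=1..k. ?H t [(\<alpha>(0 := 0)) (t - 1), ?js ! (t - 1), (\<alpha>(0 := 0)) t])"
    using assms(2) by (intro sum_PiE_trivial_first_index) (simp add: is_TTD_def)
  also have "\<dots> = (\<Sum>\<alpha> \<in> (\<Pi>\<^sub>E t\<in>{1..k}. {..<r t}).
       complex_of_real (G 1 [0, j1, \<alpha> 1]) * complex_of_real (G 2 [\<alpha> 1, j2, \<alpha> 2]) *
       (\<Prod>t=3..k. fourier_core n G t [\<alpha> (t - 1), js ! (t - 3), \<alpha> t]))"
  proof (rule sum.cong[OF refl])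
    fix \<alpha> :: "nat \<Rightarrow> nat"
    let ?f = "\<lambda>t. ?H t [(\<alpha>(0 := 0)) (t - 1), ?js ! (t - 1), (\<alpha>(0 := 0)) t]"
    have split: "{1..k} = insert 1 (insert 2 {3..k})"
      using assms(1) by auto
    have "prod ?f {3..k} = (\<Prod>t=3..k. fourier_core n G t [\<alpha> (t - 1), js ! (t - 3), \<alpha> t])"
    proof (rule prod.cong[OF refl])
      fix t assume t: "t \<in> {3..k}"
      then have "t - 1 = Suc (Suc (t - 3))"
        by auto
      then have "?js ! (t - 1) = js ! (t - 3)"
        by simp
      then show "?f t = fourier_core n G t [\<alpha> (t - 1), js ! (t - 3), \<alpha> t]"
        using t by auto
    qed
    then show "prod ?f {1..k} =
       complex_of_real (G 1 [0, j1, \<alpha> 1]) * complex_of_real (G 2 [\<alpha> 1, j2, \<alpha> 2]) *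
       (\<Prod>t=3..k. fourier_core n G t [\<alpha> (t - 1), js ! (t - 3), \<alpha> t])"
      unfolding split by (simp add: complex_tensor_def mult.assoc)
  qed
  finally show ?thesis .
qed

end
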